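(* Let $n\geq 2$ be an integer. For any integer $m\geq 1$ one has $$\dim_{\mathbb{C}}\bigl(\mathrm{Inv}_m^{(n)}\bigr)=\left|\begin{array}{cc}\binom{m+n-1}{n-1} & \binom{m+n-2}{n-1}\\ \binom{m+n-1}{n-2} & \binom{m+n-2}{n-2}\end{array}\right|,$$ where the right-hand side is a $2\times 2$ determinant of binomial coefficients.
   Context: Let $\mathbb{C}[x^{(1)},\ldots,x^{(n)}]=\mathbb{C}[x_1^{(1)},x_2^{(1)},\ldots,x_1^{(n)},x_2^{(n)}]$ be the polynomial ring in $2n$ variables. For $1\leq i<j\leq n$ the bracket $p_{ij}=[x^{(i)},x^{(j)}]$ is the polynomial $p_{ij}=x_1^{(i)}x_2^{(j)}-x_1^{(j)}x_2^{(i)}$. Let $\mathrm{Inv}^{(n)}$ be the subring of $\mathbb{C}[x^{(1)},\ldots,x^{(n)}]$ generated over $\mathbb{C}$ by all $p_{ij}$, $1\leq i<j\leq n$; it is graded by $\mathrm{Inv}^{(n)}=\bigoplus_{m\geq 0}\mathrm{Inv}_m^{(n)}$, where $\mathrm{Inv}_m^{(n)}$ is the $\mathbb{C}$-linear span of all bracket monomials $p_{i_1j_1}\cdots p_{i_mj_m}$ with $1\leq i_s<j_s\leq n$ for $s=1,\ldots,m$. (Equivalently, by the first main theorem of invariant theory, $\mathrm{Inv}_m^{(n)}$ is the space of all homogeneous polynomials of degree $2m$ in $\mathbb{C}[x^{(1)},\ldots,x^{(n)}]$, together with $0$, that are invariant under the simultaneous action of $\mathrm{SL}(2,\mathbb{C})$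 on the vectors $x^{(i)}=(x_1^{(i)},x_2^{(i)})^T$.) *)

theory Defs
  imports "HOL-Analysis.Analysis" "HOL-Library.Poly_Mapping"
begin

text \<open>
  Complex polynomials in the coordinates of finitely many plane vectors; the variable \<open>(i, k)\<close> is the
  \<open>k\<close>-th coordinate of the \<open>i\<close>-th vector. The variables are indexed by all of
  \<open>nat \<times> nat\<close>, so that one type contains the polynomial ring in \<open>2n\<close> variables for every
  \<open>n\<close>; that ring consists of the polynomials involving only the variables \<open>(i, k)\<close> with
  \<open>1 \<le> i \<le> n\<close> and \<open>k \<in> {1, 2}\<close>. Monomials are exponent vectors of finite support.
\<close>

type_synonym cpoly = "(nat \<times> nat \<Rightarrow>\<^sub>0 nat) \<Rightarrow>\<^sub>0 complex"

definition xvar :: "nat \<Rightarrow> nat \<Rightarrow> cpoly" where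
  "xvar i k = Poly_Mapping.single (Poly_Mapping.single (i, k) 1) 1"

definition cscale :: "complex \<Rightarrow> cpoly \<Rightarrow> cpoly" where
  "cscale c p = Poly_Mapping.map ((*) c) p"

lemma cscale_conv_mult: "cscale c p = Poly_Mapping.single 0 c * p"
  by (simp add: cscale_def mult_map_scale_conv_mult)

global_interpretation cpoly: vector_space cscale
proof
  fix a b :: complex and p q :: cpoly
  show "cscale a (p + q) = cscale a p + cscale a q"
    by (simp add: cscale_conv_mult distrib_left)
  show "cscale (a + b) p = cscale a p + cscale b p"
    by (simp add: cscale_conv_mult single_add distrib_right)
  show "cscale a (cscale b p) = cscale (a * b) p"
    by (simp add: cscale_conv_mult mult_single flip: mult.assoc)
  show "cscale 1 p = p"
    by (simp add: cscale_conv_mult)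
qed

definition bracket :: "nat \<Rightarrow> nat \<Rightarrow> cpoly" where
  "bracket i j = xvar i 1 * xvar j 2 - xvar j 1 * xvar i 2"

definition bracket_monomials :: "nat \<Rightarrow> nat \<Rightarrow> cpoly set" where
  "bracket_monomials n m =
     {\<Prod>s\<in>{1..m}. bracket (i s) (j s) | i j. \<forall>s\<in>{1..m}. 1 \<le> i s \<and> i s < j s \<and> j s \<le> n}"

definition Inv :: "nat \<Rightarrow> nat \<Rightarrow> cpoly set" where
  "Inv n m = cpoly.span (bracket_monomials n m)"

end

theory Submission
  imports Defs
begin

text \<open>
  A bracket monomial is a product of brackets \<open>[i, j]\<close> with \<open>i < j\<close>. Two factors \<open>[a, d]\<close> and
  \<open>[b, c]\<close> are nested if \<open>a < b < c < d\<close>, and the Pluecker relation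
  \<open>[a, d] [b, c] = [a, c] [b, d] - [a, b] [c, d]\<close> writes it as a difference of two
  products without nesting. In both of these the sum of the squared lengths \<open>(j - i)\<^sup>2\<close> is smaller, so
  repeating this terminates, and the monomials without nested factors span (\<open>straightening\<close>).

  In such a monomial any two factors are comparable in the componentwise order, so the factors can be
  listed with first entries \<open>I\<close> and second entries \<open>J\<close> both weakly increasing: the
  monomial is a semistandard tableau with rows \<open>I\<close> and \<open>J\<close> of length \<open>m\<close>. Give the variable
  \<open>(j, 2)\<close> weight \<open>j\<close> and the variables \<open>(i, 1)\<close> weight 0. The
  heaviest term of \<open>[i, j]\<close> is then the product of the variables \<open>(i, 1)\<close> and \<open>(j, 2)\<close>, hence the
  heaviest term of the monomial of \<open>(I, J)\<close> records \<open>I\<close> and \<open>J\<close> as multisets. Different tableaux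
  have different heaviest terms, and so their monomials are linearly independent
  (\<open>independent_standard_monomials\<close>).

  The dimension is therefore the number of semistandard tableaux with two rows of length \<open>m\<close> and entries
  in \<open>{1..n}\<close>. Removing the entries equal to \<open>n\<close> leaves a tableau with rows of lengths
  \<open>p' \<ge> q'\<close> and entries below \<open>n\<close>; so rows of different lengths have to be admitted, and the count for
  lengths \<open>p \<ge> q\<close> satisfies a recursion in \<open>n\<close> that telescopes to the Jacobi-Trudi determinant
  \<open>h\<^sub>p h\<^sub>q - h\<^sub>p\<^sub>+\<^sub>1 h\<^sub>q\<^sub>-\<^sub>1\<close> in the numbers \<open>h\<^sub>k\<close> of multisets of size \<open>k\<close> over \<open>{1..n}\<close>
  (\<open>card_semistandard\<close>). For \<open>p = q = m\<close> two applications of Pascal's rule turn it into the stated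
  determinant.
\<close>

section \<open>Counting two-rowed semistandard tableaux\<close>

definition semistandard :: "nat \<Rightarrow> nat \<Rightarrow> nat \<Rightarrow> (nat list \<times> nat list) set" where
  "semistandard n p q =
     {(I, J). length I = p \<and> sorted I \<and> set I \<subseteq> {1..n} \<and>
              length J = q \<and> sorted J \<and> set J \<subseteq> {1..n} \<and> (\<forall>s<q. I ! s < J ! s)}"

lemma finite_semistandard: "finite (semistandard n p q)"
proof (rule finite_subset)
  show "semistandard n p q \<subseteq>
    {I. set I \<subseteq> {1..n} \<and> length I = p} \<times> {J. set J \<subseteq> {1..n} \<and> length J = q}"
    by (auto simp: semistandard_def)
qed (simp add: finite_lists_length_eq)

lemma sorted_split_largest:
  assumes "sorted xs" "set xs \<subseteq> {1..Suc n}"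
  obtains ys where "sorted ys" "set ys \<subseteq> {1..n}" "length ys \<le> length xs"
    "xs = ys @ replicate (length xs - length ys) (Suc n)"
proof -
  have "\<exists>ys. sorted ys \<and> set ys \<subseteq> {1..n} \<and> length ys \<le> length xs \<and>
          xs = ys @ replicate (length xs - length ys) (Suc n)"
    using assms
  proof (induction xs rule: rev_induct)
    case (snoc x xs)
    then obtain ys where ys: "sorted ys" "set ys \<subseteq> {1..n}" "length ys \<le> length xs"
      "xs = ys @ replicate (length xs - length ys) (Suc n)"
      by (auto simp: sorted_append)
    show ?case
    proof (cases "x = Suc n")
      case True
      have "xs @ [x] = ys @ replicate (length (xs @ [x]) - length ys) (Suc n)"
        using ys(3) True by (subst ys(4)) (simp add: Suc_diff_le replicate_append_same)
      then show ?thesis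
        using ys by (intro exI[of _ ys]) auto
    next
      case False
      then have "set (xs @ [x]) \<subseteq> {1..n}"
        using snoc.prems by (fastforce simp: sorted_append)
      then show ?thesis
        using snoc.prems by (intro exI[of _ "xs @ [x]"]) auto
    qed
  qed simp
  then show thesis
    using that by blast
qed

text \<open>
  Deleting the largest possible entry \<open>n\<close> from both rows of a tableau can be undone once the original
  row lengths \<open>p\<close> and \<open>q\<close> are known.
\<close>

definition append_largest :: "nat \<Rightarrow> nat \<Rightarrow> nat \<Rightarrow> nat list \<times> nat list \<Rightarrow> nat list \<times> nat list" where
  "append_largest n p q = (\<lambda>(I, J). (I @ replicate (p - length I) n, J @ replicate (q - length J) n))"

text \<open>
  The bound \<open>q \<le> p'\<close> expresses that an entry \<open>Suc n\<close> of the first row must not stand above any entry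
  of the second row, because nothing larger is available there. No other condition links the appended
  entries to the rest.
\<close>

lemma semistandard_Suc:
  assumes "q \<le> p"
  shows "semistandard (Suc n) p q =
    append_largest (Suc n) p q ` (\<Union>(p', q')\<in>{q..p} \<times> {..q}. semistandard n p' q')"
    (is "?L = ?R")
proof
  show "?L \<subseteq> ?R"
  proof
    fix T assume "T \<in> ?L"
    then obtain I J where T: "T = (I, J)"
      and I: "length I = p" "sorted I" "set I \<subseteq> {1..Suc n}"
      and J: "length J = q" "sorted J" "set J \<subseteq> {1..Suc n}"
      and lt: "\<forall>s<q. I ! s < J ! s"
      by (auto simp: semistandard_def)
    obtain I' where I': "sorted I'" "set I' \<subseteq> {1..n}" "length I' \<le> length I"
      "I = I' @ replicate (length I - length I') (Suc n)"
      using sorted_split_largest[OF I(2,3)] .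
    obtain J' where J': "sorted J'" "set J' \<subseteq> {1..n}" "length J' \<le> length J"
      "J = J' @ replicate (length J - length J') (Suc n)"
      using sorted_split_largest[OF J(2,3)] .
    have nthI: "I ! s = (if s < length I' then I' ! s else Suc n)" if "s < p" for s
      using that I(1) I'(3) by (subst I'(4)) (auto simp: nth_append)
    have nthJ: "J ! s = (if s < length J' then J' ! s else Suc n)" if "s < q" for s
      using that J(1) J'(3) by (subst J'(4)) (auto simp: nth_append)
    have J_le: "J ! s \<le> Suc n" if "s < q" for s
      using that J(1,3) nth_mem[of s J] by fastforce
    \<comment> \<open>Otherwise the entry of \<open>J\<close> below the first \<open>Suc n\<close> in \<open>I\<close> would exceed \<open>Suc n\<close>.\<close>
    have q_le: "q \<le> length I'"
    proof (rule ccontr)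
      assume "\<not> q \<le> length I'"
      then have "length I' < q" by simp
      with nthI[of "length I'"] assms lt J_le[of "length I'"] show False
        by fastforce
    qed
    have "I' ! s < J' ! s" if "s < length J'" for s
      using that lt nthI[of s] nthJ[of s] q_le J'(3) J(1) assms by (auto dest: spec[of _ s])
    then have "(I', J') \<in> semistandard n (length I') (length J')"
      using I' J' by (auto simp: semistandard_def)
    moreover have "T = append_largest (Suc n) p q (I', J')"
      using T I'(4) J'(4) I(1) J(1) by (simp add: append_largest_def)
    ultimately show "T \<in> ?R"
      using q_le I'(3) J'(3) I(1) J(1) by force
  qed
  show "?R \<subseteq> ?L"
  proof
    fix T assume "T \<in> ?R"
    then obtain I' J' where T: "T = append_largest (Suc n) p q (I', J')"
      and I': "q \<le> length I'" "length I' \<le> p" "sorted I'" "set I' \<subseteq> {1..n}"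
      and J': "length J' \<le> q" "sorted J'" "set J' \<subseteq> {1..n}"
      and lt: "\<forall>s<length J'. I' ! s < J' ! s"
      by (auto simp: semistandard_def)
    have "I' ! s < Suc n" if "s < q" for s
      using that I' nth_mem[of s I'] by fastforce
    then have "(I' @ replicate (p - length I') (Suc n)) ! s < (J' @ replicate (q - length J') (Suc n)) ! s"
      if "s < q" for s
      using that lt I'(1) by (auto simp: nth_append)
    moreover have "x \<le> Suc n" if "x \<in> set I' \<union> set J'" for x
      using that I'(4) J'(3) by fastforce
    ultimately show "T \<in> ?L"
      using I' J' by (fastforce simp: T append_largest_def semistandard_def sorted_append)
  qed
qed

lemma inj_on_append_largest:
  "inj_on (append_largest (Suc n) p q) (\<Union>(p', q')\<in>A. semistandard n p' q')"
proof (rule inj_on_inverseI)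
  fix T assume "T \<in> (\<Union>(p', q')\<in>A. semistandard n p' q')"
  then obtain I J where T: "T = (I, J)" and IJ: "set I \<subseteq> {1..n}" "set J \<subseteq> {1..n}"
    by (auto simp: semistandard_def)
  have "filter (\<lambda>x. x \<le> n) I = I" "filter (\<lambda>x. x \<le> n) J = J"
    using IJ by (auto simp: filter_id_conv)
  then show "map_prod (filter (\<lambda>x. x \<le> n)) (filter (\<lambda>x. x \<le> n)) (append_largest (Suc n) p q T) = T"
    by (simp add: T append_largest_def)
qed

lemma card_semistandard_Suc:
  assumes "q \<le> p"
  shows "card (semistandard (Suc n) p q) = (\<Sum>p'\<in>{q..p}. \<Sum>q'\<in>{..q}. card (semistandard n p' q'))"
proof -
  have "card (semistandard (Suc n) p q) =
      card (\<Union>(p', q')\<in>{q..p} \<times> {..q}. semistandard n p' q')"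
    unfolding semistandard_Suc[OF assms] by (rule card_image[OF inj_on_append_largest])
  also have "\<dots> = (\<Sum>(p', q')\<in>{q..p} \<times> {..q}. card (semistandard n p' q'))"
    by (subst card_UN_disjoint)
      (auto simp: finite_semistandard case_prod_unfold, auto simp: semistandard_def)
  finally show ?thesis
    by (simp add: sum.cartesian_product)
qed

text \<open>
  The number of multisets of size \<open>k\<close> over \<open>n\<close> elements, that is, \<open>h\<^sub>k(1, \<dots>, 1)\<close> for the
  complete homogeneous symmetric polynomial in \<open>n\<close> variables. For \<open>n = k = 0\<close> the truncated
  subtraction yields the value 1, as it should.
\<close>

definition multichoose :: "nat \<Rightarrow> nat \<Rightarrow> int" where
  "multichoose n k = int ((n + k - 1) choose k)"

text \<open>
  This stands for \<open>h\<^sub>k\<^sub>-\<^sub>1\<close> with the convention \<open>h\<^sub>-\<^sub>1 = 0\<close>, which truncated subtraction would miss.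
\<close>

definition multichoose_pred :: "nat \<Rightarrow> nat \<Rightarrow> int" where
  "multichoose_pred n k = (if k = 0 then 0 else multichoose n (k - 1))"

lemma multichoose_0 [simp]: "multichoose n 0 = 1"
  by (simp add: multichoose_def)

lemma multichoose_0_left: "multichoose 0 k = (if k = 0 then 1 else 0)"
  by (simp add: multichoose_def)

lemma multichoose_pred_0 [simp]: "multichoose_pred n 0 = 0"
  by (simp add: multichoose_pred_def)

lemma multichoose_pred_Suc [simp]: "multichoose_pred n (Suc k) = multichoose n k"
  by (simp add: multichoose_pred_def)

lemma multichoose_Suc_Suc:
  "multichoose (Suc n) (Suc k) = multichoose (Suc n) k + multichoose n (Suc k)"
  by (simp add: multichoose_def)

lemma sum_multichoose_atMost: "(\<Sum>k\<le>q. multichoose n k) = multichoose (Suc n) q"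
  by (induction q) (simp_all add: multichoose_Suc_Suc)

lemma sum_multichoose_pred_atMost: "(\<Sum>k\<le>q. multichoose_pred n k) = multichoose_pred (Suc n) q"
  by (cases q) (simp_all add: sum.atMost_Suc_shift sum_multichoose_atMost del: sum.atMost_Suc)

lemma sum_multichoose_interval:
  assumes "q \<le> p"
  shows "(\<Sum>k\<in>{q..p}. multichoose n k) = multichoose (Suc n) p - multichoose_pred (Suc n) q"
  using assms
proof (induction p rule: dec_induct)
  case base
  then show ?case by (cases q) (simp_all add: multichoose_Suc_Suc)
qed (simp add: multichoose_Suc_Suc)

text \<open>
  The formula factorises the double sum in \<open>card_semistandard_Suc\<close> into single sums, each of which
  telescopes. The two boundary terms \<open>h\<^sub>q\<^sub>-\<^sub>1 h\<^sub>q\<close> that arise have opposite signs and cancel.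
\<close>

lemma card_semistandard:
  assumes "q \<le> p"
  shows "int (card (semistandard n p q)) =
    multichoose n p * multichoose n q - multichoose n (Suc p) * multichoose_pred n q"
  using assms
proof (induction n arbitrary: p q)
  case 0
  have "semistandard 0 p q = (if p = 0 \<and> q = 0 then {([], [])} else {})"
    by (auto simp: semistandard_def)
  with 0 show ?case
    by (auto simp: multichoose_0_left)
next
  case (Suc n)
  let ?h = "multichoose n" and ?H = "multichoose (Suc n)"
  let ?h' = "multichoose_pred n" and ?H' = "multichoose_pred (Suc n)"
  have shift: "(\<Sum>p'\<in>{q..p}. ?h (Suc p')) = ?H (Suc p) - ?H q"
    using sum_multichoose_interval[of "Suc q" "Suc p" n] Suc.prems
    by (simp add: sum.shift_bounds_cl_Suc_ivl del: sum.cl_ivl_Suc)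
  have "int (card (semistandard (Suc n) p q)) =
      (\<Sum>p'\<in>{q..p}. \<Sum>q'\<le>q. ?h p' * ?h q' - ?h (Suc p') * ?h' q')"
    unfolding card_semistandard_Suc[OF Suc.prems] of_nat_sum
    by (intro sum.cong refl Suc.IH) auto
  also have "\<dots> = (\<Sum>p'\<in>{q..p}. ?h p') * (\<Sum>q'\<le>q. ?h q') - (\<Sum>p'\<in>{q..p}. ?h (Suc p')) * (\<Sum>q'\<le>q. ?h' q')"
    by (simp add: sum_subtractf sum_product)
  also have "\<dots> = (?H p - ?H' q) * ?H q - (?H (Suc p) - ?H q) * ?H' q"
    using Suc.prems
    by (simp only: shift sum_multichoose_interval sum_multichoose_atMost sum_multichoose_pred_atMost)
  finally show ?case
    by (simp add: algebra_simps)
qed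

section \<open>Leading exponents\<close>

text \<open>
  A weight on exponents replaces a monomial order here. It need not separate the exponents, so it is
  required that the part of maximal weight is a single term, with coefficient 1.
\<close>

definition has_leading_exponent :: "('a::monoid_add \<Rightarrow> nat) \<Rightarrow> ('a \<Rightarrow>\<^sub>0 'b::comm_ring_1) \<Rightarrow> 'a \<Rightarrow> bool" where
  "has_leading_exponent w f l \<longleftrightarrow>
     (\<exists>r. f = Poly_Mapping.single l 1 + r \<and> (\<forall>e\<in>Poly_Mapping.keys r. w e < w l))"

lemma has_leading_exponent_lookup:
  assumes "has_leading_exponent w f l"
  shows "Poly_Mapping.lookup f l = 1"
    and "Poly_Mapping.lookup f e \<noteq> 0 \<Longrightarrow> e = l \<or> w e < w l"
proof -
  obtain r where r: "f = Poly_Mapping.single l 1 + r" "\<forall>e\<in>Poly_Mapping.keys r. w e < w l"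
    using assms by (auto simp: has_leading_exponent_def)
  from r(2) have "l \<notin> Poly_Mapping.keys r" by blast
  with r(1) show "Poly_Mapping.lookup f l = 1"
    by (simp add: lookup_add in_keys_iff)
  show "e = l \<or> w e < w l" if "Poly_Mapping.lookup f e \<noteq> 0"
    using that r by (auto simp: lookup_add lookup_single in_keys_iff when_def split: if_splits)
qed

lemma has_leading_exponent_unique:
  fixes f :: "'a::monoid_add \<Rightarrow>\<^sub>0 'b::comm_ring_1"
  assumes "has_leading_exponent w f l" "has_leading_exponent w f l'"
  shows "l = l'"
  using has_leading_exponent_lookup[OF assms(1)] has_leading_exponent_lookup[OF assms(2)]
  by (metis less_asym zero_neq_one)

lemma has_leading_exponent_1: "has_leading_exponent w 1 0"
  unfolding has_leading_exponent_def by (rule exI[of _ 0]) simp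

lemma has_leading_exponent_mult:
  fixes f g :: "'a::monoid_add \<Rightarrow>\<^sub>0 'b::comm_ring_1"
  assumes add: "\<And>a b. w (a + b) = w a + w b"
    and "has_leading_exponent w f l" "has_leading_exponent w g l'"
  shows "has_leading_exponent w (f * g) (l + l')"
proof -
  obtain r where r: "f = Poly_Mapping.single l 1 + r" "\<forall>e\<in>Poly_Mapping.keys r. w e < w l"
    using assms(2) by (auto simp: has_leading_exponent_def)
  obtain r' where r': "g = Poly_Mapping.single l' 1 + r'" "\<forall>e\<in>Poly_Mapping.keys r'. w e < w l'"
    using assms(3) by (auto simp: has_leading_exponent_def)
  define R where "R = Poly_Mapping.single l 1 * r' + r * g"
  have "f * g = Poly_Mapping.single (l + l') 1 + R"
    by (simp add: R_def r(1) r'(1) algebra_simps mult_single)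
  moreover have "w e < w (l + l')" if e: "e \<in> Poly_Mapping.keys R" for e
  proof -
    have le: "w b \<le> w l'" if "b \<in> Poly_Mapping.keys g" for b
      using has_leading_exponent_lookup(2)[OF assms(3), of b] that by (auto simp: in_keys_iff)
    have "e \<in> Poly_Mapping.keys (Poly_Mapping.single l (1::'b) * r') \<union> Poly_Mapping.keys (r * g)"
      using e Poly_Mapping.keys_add[of "Poly_Mapping.single l 1 * r'" "r * g"] by (auto simp: R_def)
    then consider "e \<in> Poly_Mapping.keys (Poly_Mapping.single l (1::'b) * r')"
      | "e \<in> Poly_Mapping.keys (r * g)" by blast
    then show ?thesis
    proof cases
      case 1
      then obtain b where "e = l + b" "b \<in> Poly_Mapping.keys r'"
        using keys_mult[of "Poly_Mapping.single l (1::'b)" r'] by auto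
      with r'(2) show ?thesis by (simp add: add)
    next
      case 2
      then obtain a b where "e = a + b" "a \<in> Poly_Mapping.keys r" "b \<in> Poly_Mapping.keys g"
        using keys_mult[of r g] by auto
      with r(2) le[of b] show ?thesis by (simp add: add add_less_le_mono)
    qed
  qed
  ultimately show ?thesis
    by (auto simp: has_leading_exponent_def)
qed

text \<open>
  In a linear relation, take a polynomial whose leading exponent has maximal weight among those with
  nonzero coefficient. No other polynomial of the relation contains that exponent: it could not be the
  leading exponent of that polynomial, by injectivity, nor have smaller weight than that leading
  exponent, by maximality.
\<close>

lemma independent_if_distinct_leading_exponents:
  fixes B :: "cpoly set"
  assumes "finite B" and lead: "\<And>f. f \<in> B \<Longrightarrow> has_leading_exponent w f (l f)" and "inj_on l B"
  shows "cpoly.independent B"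
proof
  assume "cpoly.dependent B"
  then obtain u g where ug: "g \<in> B" "u g \<noteq> 0" and sum: "(\<Sum>f\<in>B. cscale (u f) f) = 0"
    using cpoly.dependent_finite[OF \<open>finite B\<close>] by auto
  define A where "A = {f \<in> B. u f \<noteq> 0}"
  have "finite A" "A \<noteq> {}"
    using ug \<open>finite B\<close> by (auto simp: A_def)
  then have "Max ((\<lambda>f. w (l f)) ` A) \<in> (\<lambda>f. w (l f)) ` A"
    by (intro Max_in) auto
  then obtain h where h: "h \<in> A" and h_max: "w (l h) = Max ((\<lambda>f. w (l f)) ` A)"
    by auto
  have max: "w (l f) \<le> w (l h)" if "f \<in> A" for f
    using that \<open>finite A\<close> by (simp add: h_max)
  have scale: "Poly_Mapping.lookup (cscale c f) e = c * Poly_Mapping.lookup f e" for c f e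
    by (simp add: cscale_def Poly_Mapping.map.rep_eq when_def)
  have other: "u f * Poly_Mapping.lookup f (l h) = 0" if "f \<in> B" "f \<noteq> h" for f
  proof (rule ccontr)
    assume nz: "u f * Poly_Mapping.lookup f (l h) \<noteq> 0"
    then have "f \<in> A" using that by (auto simp: A_def)
    have "l h = l f \<or> w (l h) < w (l f)"
      using nz has_leading_exponent_lookup(2)[OF lead[OF that(1)], of "l h"] by auto
    moreover have "l h \<noteq> l f"
      using that h \<open>inj_on l B\<close> by (auto simp: A_def inj_on_def)
    ultimately show False
      using max[OF \<open>f \<in> A\<close>] by simp
  qed
  have "0 = (\<Sum>f\<in>B. u f * Poly_Mapping.lookup f (l h))"
    using arg_cong[OF sum, of "\<lambda>p. Poly_Mapping.lookup p (l h)"] by (simp add: lookup_sum scale)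
  also have "\<dots> = (\<Sum>f\<in>B. if f = h then u h * Poly_Mapping.lookup h (l h) else 0)"
    using other by (intro sum.cong) auto
  also have "\<dots> = u h"
    using h \<open>finite B\<close> has_leading_exponent_lookup(1)[OF lead[of h]] by (simp add: A_def)
  finally show False
    using h by (simp add: A_def)
qed

section \<open>Standard bracket monomials are linearly independent\<close>

definition standard_monomial :: "nat list \<times> nat list \<Rightarrow> cpoly" where
  "standard_monomial = (\<lambda>(I, J). prod_list (map2 bracket I J))"

text \<open>
  The exponent of the heaviest term of \<open>standard_monomial\<close>. It determines both rows as multisets, and
  hence as sorted lists.
\<close>

definition content :: "nat list \<times> nat list \<Rightarrow> (nat \<times> nat \<Rightarrow>\<^sub>0 nat)" where
  "content = (\<lambda>(I, J). sum_list (map2 (\<lambda>i j. Poly_Mapping.single (i, 1) 1 + Poly_Mapping.single (j, 2) 1) I J))"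

text \<open>
  This weight favours the term of a bracket in which the larger index carries the second coordinate.
  Restricting the sum to \<open>{1..n}\<close> makes additivity immediate.
\<close>

definition second_weight :: "nat \<Rightarrow> (nat \<times> nat \<Rightarrow>\<^sub>0 nat) \<Rightarrow> nat" where
  "second_weight n e = (\<Sum>i\<in>{1..n}. i * Poly_Mapping.lookup e (i, 2))"

lemma second_weight_add: "second_weight n (a + b) = second_weight n a + second_weight n b"
  by (simp add: second_weight_def lookup_add algebra_simps sum.distrib)

lemma second_weight_pair:
  assumes "j \<in> {1..n}"
  shows "second_weight n (Poly_Mapping.single (i, 1) 1 + Poly_Mapping.single (j, 2) 1) = j"
proof -
  have "second_weight n (Poly_Mapping.single (i, 1) 1 + Poly_Mapping.single (j, 2) 1) =
      (\<Sum>k\<in>{1..n}. if k = j then j else 0)"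
    unfolding second_weight_def
    by (intro sum.cong) (auto simp: lookup_add lookup_single when_def)
  then show ?thesis using assms by simp
qed

lemma has_leading_exponent_bracket:
  assumes "1 \<le> i" "i < j" "j \<le> n"
  shows "has_leading_exponent (second_weight n) (bracket i j)
           (Poly_Mapping.single (i, 1) 1 + Poly_Mapping.single (j, 2) 1)"
  unfolding has_leading_exponent_def
proof (intro exI conjI)
  let ?r = "- Poly_Mapping.single (Poly_Mapping.single (j, 1) 1 + Poly_Mapping.single (i, 2) 1) 1 :: cpoly"
  show "bracket i j = Poly_Mapping.single (Poly_Mapping.single (i, 1) 1 + Poly_Mapping.single (j, 2) 1) 1 + ?r"
    by (simp add: bracket_def xvar_def mult_single)
  show "\<forall>e\<in>Poly_Mapping.keys ?r. second_weight n e <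
      second_weight n (Poly_Mapping.single (i, 1) 1 + Poly_Mapping.single (j, 2) 1)"
    using assms by (simp add: second_weight_pair del: One_nat_def)
qed

lemma has_leading_exponent_standard_monomial:
  assumes "T \<in> semistandard n m m"
  shows "has_leading_exponent (second_weight n) (standard_monomial T) (content T)"
proof -
  obtain I J where T: "T = (I, J)" by fastforce
  have "length I = length J" "set I \<subseteq> {1..n}" "set J \<subseteq> {1..n}" "\<forall>s<length J. I ! s < J ! s"
    using assms by (auto simp: T semistandard_def)
  then show ?thesis unfolding T
  proof (induction I J rule: list_induct2)
    case Nil
    then show ?case
      by (simp add: standard_monomial_def content_def has_leading_exponent_1)
  next
    case (Cons i I j J)
    have "I ! s < J ! s" if "s < length J" for s
      using Cons.prems(3) that by (auto dest: spec[of _ "Suc s"])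
    moreover have "i < j"
      using Cons.prems(3) by (auto dest: spec[of _ 0])
    ultimately show ?case
      using Cons has_leading_exponent_mult[OF second_weight_add has_leading_exponent_bracket[of i j n], of _ "content (I, J)"]
      by (simp add: standard_monomial_def content_def)
  qed
qed

lemma lookup_content:
  assumes "length I = length J"
  shows "Poly_Mapping.lookup (content (I, J)) (k, 1) = count (mset I) k"
    and "Poly_Mapping.lookup (content (I, J)) (k, 2) = count (mset J) k"
  using assms
  by (induction I J rule: list_induct2) (auto simp: content_def lookup_add lookup_single when_def)

lemma inj_on_content: "inj_on content (semistandard n m m)"
proof (rule inj_onI)
  fix T T' assume *: "T \<in> semistandard n m m" "T' \<in> semistandard n m m" "content T = content T'"
  obtain I J I' J' where T: "T = (I, J)" "T' = (I', J')" by fastforce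
  have len: "length I = length J" "length I' = length J'"
    using * by (auto simp: T semistandard_def)
  have "mset I = mset I'" "mset J = mset J'"
    using *(3) lookup_content[OF len(1)] lookup_content[OF len(2)] by (auto simp: T multiset_eq_iff)
  moreover have "sorted I" "sorted I'" "sorted J" "sorted J'"
    using * by (auto simp: T semistandard_def)
  ultimately show "T = T'"
    by (metis T properties_for_sort)
qed

lemma inj_on_standard_monomial: "inj_on standard_monomial (semistandard n m m)"
  by (metis (mono_tags, lifting) has_leading_exponent_standard_monomial has_leading_exponent_unique
      inj_onI inj_on_contraD[OF inj_on_content])

lemma independent_standard_monomials:
  "cpoly.independent (standard_monomial ` semistandard n m m)"
proof (rule independent_if_distinct_leading_exponents)
  let ?inv = "the_inv_into (semistandard n m m) standard_monomial"
  have inv: "?inv (standard_monomial T) = T" if "T \<in> semistandard n m m" for T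
    using that inj_on_standard_monomial by (simp add: the_inv_into_f_f)
  show "has_leading_exponent (second_weight n) f (content (?inv f))"
    if "f \<in> standard_monomial ` semistandard n m m" for f
    using that by (auto simp: inv has_leading_exponent_standard_monomial)
  show "inj_on (\<lambda>f. content (?inv f)) (standard_monomial ` semistandard n m m)"
    using inj_on_content by (auto simp: inj_on_def inv)
qed (simp add: finite_semistandard)

section \<open>Standard bracket monomials span\<close>

lemma pluecker_relation:
  "bracket a d * bracket b c = bracket a c * bracket b d - bracket a b * bracket c d"
  by (simp add: bracket_def algebra_simps)

text \<open>
  Without nested pairs the componentwise order is total on the factors, and so sorting by the sum
  \<open>i + j\<close> sorts both components at once.
\<close>

lemma nonnesting_imp_standard:
  assumes valid: "\<And>i j. (i, j) \<in># M \<Longrightarrow> 1 \<le> i \<and> i < j \<and> j \<le> n"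
    and nonnesting: "\<And>i j i' j'. (i, j) \<in># M \<Longrightarrow> (i', j') \<in># M \<Longrightarrow> i < i' \<Longrightarrow> j \<le> j'"
  shows "(\<Prod>(i, j)\<in>#M. bracket i j) \<in> standard_monomial ` semistandard n (size M) (size M)"
proof -
  obtain xs0 where xs0: "mset xs0 = M" using ex_mset by blast
  define xs where "xs = sort_key (\<lambda>x. fst x + snd x) xs0"
  have xs: "mset xs = M" by (simp add: xs_def xs0)
  then have set_xs: "set xs = set_mset M" by (metis set_mset_mset)
  have sum_sorted: "sorted_wrt (\<lambda>x y. fst x + snd x \<le> fst y + snd y) xs"
    using sorted_sort_key[of "\<lambda>x. fst x + snd x" xs0] by (simp add: xs_def sorted_map)
  have le: "fst x \<le> fst y" "snd x \<le> snd y"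
    if "x \<in> set xs" "y \<in> set xs" "fst x + snd x \<le> fst y + snd y" for x y
  proof -
    have "fst x < fst y \<longrightarrow> snd x \<le> snd y" "fst y < fst x \<longrightarrow> snd y \<le> snd x"
      using that(1,2) nonnesting[of "fst x" "snd x" "fst y" "snd y"]
        nonnesting[of "fst y" "snd y" "fst x" "snd x"] by (simp_all add: set_xs)
    with that(3) show "fst x \<le> fst y" "snd x \<le> snd y" by linarith+
  qed
  have "sorted_wrt (\<lambda>x y. fst x \<le> fst y) xs"
    by (rule sorted_wrt_mono_rel[OF le(1) sum_sorted])
  moreover have "sorted_wrt (\<lambda>x y. snd x \<le> snd y) xs"
    by (rule sorted_wrt_mono_rel[OF le(2) sum_sorted])
  ultimately have "sorted (map fst xs)" "sorted (map snd xs)"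
    by (simp_all add: sorted_map)
  moreover have entries: "1 \<le> fst x \<and> fst x < snd x \<and> snd x \<le> n" if "x \<in> set xs" for x
    using valid[of "fst x" "snd x"] that by (simp add: set_xs)
  moreover have "set (map fst xs) \<subseteq> {1..n}" "set (map snd xs) \<subseteq> {1..n}"
    using entries by fastforce+
  moreover have "size M = length xs"
    using xs by auto
  ultimately have "(map fst xs, map snd xs) \<in> semistandard n (size M) (size M)"
    by (simp add: semistandard_def entries)
  moreover have "(\<Prod>(i, j)\<in>#M. bracket i j) = standard_monomial (map fst xs, map snd xs)"
    by (simp add: standard_monomial_def zip_map_fst_snd flip: xs prod_mset_prod_list)
  ultimately show ?thesis by blast
qed

text \<open>
  Induction on the sum of the squared lengths of the factors. With consecutive gaps \<open>x\<close>, \<open>y\<close>, \<open>z\<close>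
  between \<open>a < b < c < d\<close>, a nested pair contributes \<open>(x + y + z)\<^sup>2 + y\<^sup>2\<close>, while the two pairs that
  replace it contribute \<open>(x + y)\<^sup>2 + (y + z)\<^sup>2\<close> and \<open>x\<^sup>2 + z\<^sup>2\<close>, which are both smaller.
\<close>

lemma straightening:
  assumes "\<And>i j. (i, j) \<in># M \<Longrightarrow> 1 \<le> i \<and> i < j \<and> j \<le> n"
  shows "(\<Prod>(i, j)\<in>#M. bracket i j) \<in>
    cpoly.span (standard_monomial ` semistandard n (size M) (size M))"
  using assms
proof (induction "\<Sum>(i, j)\<in>#M. (j - i)\<^sup>2" arbitrary: M rule: less_induct)
  case less
  show ?case
  proof (cases "\<exists>a d b c. (a, d) \<in># M \<and> (b, c) \<in># M \<and> a < b \<and> c < d")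
    case False
    have "(\<Prod>(i, j)\<in>#M. bracket i j) \<in> standard_monomial ` semistandard n (size M) (size M)"
    proof (rule nonnesting_imp_standard)
      show "1 \<le> i \<and> i < j \<and> j \<le> n" if "(i, j) \<in># M" for i j
        using that by (rule less.prems)
      show "j \<le> j'" if "(i, j) \<in># M" "(i', j') \<in># M" "i < i'" for i j i' j'
        using False that by (meson not_le)
    qed
    then show ?thesis by (rule cpoly.span_base)
  next
    case True
    then obtain a b c d where *: "(a, d) \<in># M" "(b, c) \<in># M" "a < b" "c < d" by blast
    obtain M0 where M0: "M = add_mset (a, d) M0"
      using *(1) by (meson multi_member_split)
    with *(2,3) have "(b, c) \<in># M0" by auto
    then obtain N where "M0 = add_mset (b, c) N"
      by (meson multi_member_split)
    with M0 have M: "M = N + {#(a, d), (b, c)#}" by simp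
    have "b < c" "1 \<le> a" "d \<le> n"
      using less.prems[OF *(1)] less.prems[OF *(2)] by simp_all
    define M1 where "M1 = N + {#(a, c), (b, d)#}"
    define M2 where "M2 = N + {#(a, b), (c, d)#}"
    have N: "1 \<le> i \<and> i < j \<and> j \<le> n" if "(i, j) \<in># N" for i j
      using less.prems[of i j] that M by simp
    define x y z where "x = b - a" and "y = c - b" and "z = d - c"
    then have "x > 0" "y > 0" "z > 0"
      and lengths: "b - a = x" "c - b = y" "d - c = z" "c - a = x + y" "d - b = y + z" "d - a = x + y + z"
      using *(3,4) \<open>b < c\<close> by simp_all
    have squares: "(x + y)\<^sup>2 + (y + z)\<^sup>2 < (x + y + z)\<^sup>2 + y\<^sup>2" "x\<^sup>2 + z\<^sup>2 < (x + y + z)\<^sup>2 + y\<^sup>2"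
      using \<open>x > 0\<close> \<open>y > 0\<close> \<open>z > 0\<close> by (simp_all add: power2_eq_square algebra_simps)
    have "(\<Sum>(i, j)\<in>#M1. (j - i)\<^sup>2) < (\<Sum>(i, j)\<in>#M. (j - i)\<^sup>2)"
      using squares(1) by (simp add: M1_def M lengths)
    then have 1: "(\<Prod>(i, j)\<in>#M1. bracket i j) \<in> cpoly.span (standard_monomial ` semistandard n (size M1) (size M1))"
    proof (rule less.hyps)
      show "1 \<le> i \<and> i < j \<and> j \<le> n" if "(i, j) \<in># M1" for i j
        using that N[of i j] *(3,4) \<open>b < c\<close> \<open>1 \<le> a\<close> \<open>d \<le> n\<close> by (auto simp: M1_def)
    qed
    have "(\<Sum>(i, j)\<in>#M2. (j - i)\<^sup>2) < (\<Sum>(i, j)\<in>#M. (j - i)\<^sup>2)"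
      using squares(2) by (simp add: M2_def M lengths)
    then have 2: "(\<Prod>(i, j)\<in>#M2. bracket i j) \<in> cpoly.span (standard_monomial ` semistandard n (size M2) (size M2))"
    proof (rule less.hyps)
      show "1 \<le> i \<and> i < j \<and> j \<le> n" if "(i, j) \<in># M2" for i j
        using that N[of i j] *(3,4) \<open>b < c\<close> \<open>1 \<le> a\<close> \<open>d \<le> n\<close> by (auto simp: M2_def)
    qed
    have "(\<Prod>(i, j)\<in>#M. bracket i j) = (\<Prod>(i, j)\<in>#N. bracket i j) * (bracket a d * bracket b c)"
      by (simp add: M mult_ac)
    also have "\<dots> = (\<Prod>(i, j)\<in>#M1. bracket i j) - (\<Prod>(i, j)\<in>#M2. bracket i j)"
      unfolding pluecker_relation[of a d b c] by (simp add: M1_def M2_def algebra_simps)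
    finally have eq: "(\<Prod>(i, j)\<in>#M. bracket i j) = \<dots>" .
    have "size M1 = size M" "size M2 = size M"
      by (simp_all add: M M1_def M2_def)
    with 1 2 show ?thesis
      unfolding eq by (simp add: cpoly.span_diff)
  qed
qed

lemma Inv_eq_span_standard_monomials:
  "Inv n m = cpoly.span (standard_monomial ` semistandard n m m)"
proof (rule antisym)
  show "Inv n m \<subseteq> cpoly.span (standard_monomial ` semistandard n m m)"
    unfolding Inv_def
  proof (rule cpoly.span_minimal)
    show "bracket_monomials n m \<subseteq> cpoly.span (standard_monomial ` semistandard n m m)"
    proof
      fix f assume "f \<in> bracket_monomials n m"
      then obtain i j where f: "f = (\<Prod>s\<in>{1..m}. bracket (i s) (j s))"
        and ij: "\<forall>s\<in>{1..m}. 1 \<le> i s \<and> i s < j s \<and> j s \<le> n"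
        by (auto simp: bracket_monomials_def)
      let ?M = "image_mset (\<lambda>s. (i s, j s)) (mset_set {1..m})"
      have "f = (\<Prod>(i, j)\<in>#?M. bracket i j)"
        by (simp add: f prod_unfold_prod_mset multiset.map_comp comp_def)
      moreover have "1 \<le> a \<and> a < b \<and> b \<le> n" if "(a, b) \<in># ?M" for a b
        using that ij by auto
      then have "(\<Prod>(i, j)\<in>#?M. bracket i j) \<in>
          cpoly.span (standard_monomial ` semistandard n (size ?M) (size ?M))"
        by (rule straightening)
      ultimately show "f \<in> cpoly.span (standard_monomial ` semistandard n m m)"
        by simp
    qed
  qed (rule cpoly.subspace_span)
next
  have "standard_monomial T \<in> bracket_monomials n m" if T: "T \<in> semistandard n m m" for T
  proof -
    obtain I J where T_eq: "T = (I, J)" by fastforce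
    have IJ: "length I = m" "length J = m" "set I \<subseteq> {1..n}" "set J \<subseteq> {1..n}" "\<forall>s<m. I ! s < J ! s"
      using T by (auto simp: T_eq semistandard_def)
    have "standard_monomial T = (\<Prod>s<m. bracket (I ! s) (J ! s))"
      unfolding standard_monomial_def T_eq prod.case prod.list_conv_set_nth
      using IJ(1,2) by (intro prod.cong) auto
    also have "\<dots> = (\<Prod>s\<in>{1..m}. bracket (I ! (s - 1)) (J ! (s - 1)))"
      by (rule prod.reindex_bij_witness[of _ "\<lambda>s. s - 1" Suc]) auto
    finally have eq: "standard_monomial T = \<dots>" .
    have valid: "1 \<le> I ! (s - 1) \<and> I ! (s - 1) < J ! (s - 1) \<and> J ! (s - 1) \<le> n" if "s \<in> {1..m}" for s
    proof -
      have s: "s - 1 < m" using that by auto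
      then have "I ! (s - 1) \<in> {1..n}" "J ! (s - 1) \<in> {1..n}"
        using subsetD[OF IJ(3) nth_mem[of "s - 1"]] subsetD[OF IJ(4) nth_mem[of "s - 1"]] IJ(1,2)
        by simp_all
      with s IJ(5) show ?thesis by simp
    qed
    show ?thesis
      unfolding bracket_monomials_def mem_Collect_eq
      by (intro exI[of _ "\<lambda>s. I ! (s - 1)"] exI[of _ "\<lambda>s. J ! (s - 1)"] conjI ballI eq valid)
  qed
  then show "cpoly.span (standard_monomial ` semistandard n m m) \<subseteq> Inv n m"
    unfolding Inv_def by (intro cpoly.span_mono) auto
qed

section \<open>The dimension formula\<close>

lemma dim_Inv: "cpoly.dim (Inv n m) = card (semistandard n m m)"
  unfolding Inv_eq_span_standard_monomials
    cpoly.dim_span_eq_card_independent[OF independent_standard_monomials]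
  by (rule card_image[OF inj_on_standard_monomial])

theorem theorem2p3p2:
  fixes n m :: nat
  assumes "n \<ge> 2" and "m \<ge> 1"
  shows "int (cpoly.dim (Inv n m)) =
    det (vector [vector [int ((m + n - 1) choose (n - 1)), int ((m + n - 2) choose (n - 1))],
                 vector [int ((m + n - 1) choose (n - 2)), int ((m + n - 2) choose (n - 2))]]
         :: int ^ 2 ^ 2)"
proof -
  obtain k where n: "n = k + 2"
    using assms(1) by (metis add.commute le_Suc_ex)
  obtain l where m: "m = Suc l"
    using assms(2) by (cases m) auto
  let ?C = "\<lambda>a b. int (a choose b)"
  have sym: "multichoose n r = ?C (k + 1 + r) (k + 1)" for r
    using binomial_symmetric[of r "k + 1 + r"] by (simp add: multichoose_def n)
  have pascal: "?C (Suc a) (Suc b) = ?C a b + ?C a (Suc b)" for a b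
    by simp
  have "int (cpoly.dim (Inv n m)) =
      ?C (m + k + 1) (k + 1) * ?C (m + k + 1) (k + 1) - ?C (m + k + 2) (k + 1) * ?C (m + k) (k + 1)"
    by (simp add: dim_Inv card_semistandard sym m add_ac del: binomial_Suc_Suc)
  also have "\<dots> = ?C (m + k + 1) (k + 1) * ?C (m + k) k - ?C (m + k) (k + 1) * ?C (m + k + 1) k"
    using pascal[of "m + k" k] pascal[of "m + k + 1" k]
    by (simp add: algebra_simps del: binomial_Suc_Suc)
  finally show ?thesis
    by (simp add: det_2 vector_2 n)
qed

end
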